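(* Let $I \subset \widetilde{I} \subset \mathbb{R}$ be intervals containing $0$ as an interior point. Then the following are equivalent for $g : \widetilde{I} \to \mathbb{R}$. (1) $g$ is Lebesgue measurable on $I$ and additive on $\widetilde{I}$. (2) $g$ is continuous on $I$ and additive on $\widetilde{I}$. (3) $g$ is linear on $\widetilde{I}$, i.e., there exists $\beta \in \mathbb{R}$ such that $g(x) = \beta x$ for all $x \in \widetilde{I}$.
   Context: A function $g : \widetilde{I} \to \mathbb{R}$ is additive on $\widetilde{I}$ if $g(x+y) = g(x) + g(y)$ whenever $x, y, x+y \in \widetilde{I}$. "$g$ is Lebesgue measurable (resp. continuous) on $I$" means that the restriction $g|_I$ is Lebesgue measurable (resp. continuous). Intervals may be open, closed, half-open, bounded or unbounded. *)

theory Defs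
  imports "HOL-Analysis.Analysis"
begin

definition additive_on :: "real set \<Rightarrow> (real \<Rightarrow> real) \<Rightarrow> bool" where
  "additive_on S g \<longleftrightarrow>
     (\<forall>x\<in>S. \<forall>y\<in>S. x + y \<in> S \<longrightarrow> g (x + y) = g x + g y)"

end

theory Submission
  imports Defs
begin

text \<open>
  On a bounded interval around \<open>0\<close> the sublevel sets \<open>{x. \<bar>g x\<bar> \<le> n}\<close> of a measurable \<open>g\<close>
  eventually have almost full measure, so such a set meets each of its small translates; hence every
  small number is a difference of two points of it, and the additive \<open>g\<close> is bounded by \<open>2 * n\<close> near
  \<open>0\<close>. Subtracting the linear function that agrees with \<open>g\<close> at a small \<open>c\<close> gives a bounded additive
  \<open>h\<close> with \<open>h c = 0\<close>. Every \<open>x\<close> in \<open>[0, c]\<close> is \<open>y\<close> or \<open>c - y\<close> with \<open>2 * y\<close> in \<open>[0, c]\<close>, so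
  \<open>\<bar>h x\<bar> = \<bar>h (2 * y)\<bar> / 2\<close>. Thus any bound for \<open>\<bar>h\<bar>\<close> on \<open>[0, c]\<close> can be halved indefinitely, and
  \<open>h = 0\<close> there. Linearity extends to the whole interval by \<open>g x = n * g (x / n)\<close>.
\<close>

lemma additive_onD:
  assumes "additive_on S g" "x \<in> S" "y \<in> S" "x + y \<in> S"
  shows "g (x + y) = g x + g y"
  using assms unfolding additive_on_def by blast

lemma additive_on_subset:
  assumes "additive_on S g" "T \<subseteq> S"
  shows "additive_on T g"
  using assms unfolding additive_on_def by blast

lemma additive_on_zero:
  assumes "additive_on S g" "0 \<in> S"
  shows "g 0 = 0"
  using additive_onD[OF assms(1), of 0 0] assms(2) by simp

lemma additive_on_uminus:
  assumes "additive_on S g" "0 \<in> S" "x \<in> S" "- x \<in> S"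
  shows "g (- x) = - g x"
  using additive_onD[OF assms(1), of x "- x"] additive_on_zero[OF assms(1,2)] assms by simp

lemma additive_on_diff:
  assumes "additive_on S g" "x \<in> S" "y \<in> S" "x - y \<in> S"
  shows "g (x - y) = g x - g y"
  using additive_onD[OF assms(1), of "x - y" y] assms by simp

text \<open>Induction on \<open>n\<close>, adding \<open>x\<close> once per step. All intermediate
  multiples are required to lie in \<open>S\<close>, because additivity is available only for sums
  that stay inside \<open>S\<close>.\<close>

lemma additive_on_multiple:
  assumes "additive_on S g" "0 \<in> S" "\<And>k. k \<le> n \<Longrightarrow> real k * x \<in> S"
  shows "g (real n * x) = real n * g x"
  using assms(3)
proof (induction n)
  case 0
  then show ?case using additive_on_zero[OF assms(1,2)] by simp
next
  case (Suc n)
  have "g (real n * x + x) = g (real n * x) + g x"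
  proof (rule additive_onD[OF assms(1)])
    show "real n * x \<in> S" using Suc.prems[of n] by simp
    show "x \<in> S" using Suc.prems[of 1] by simp
    show "real n * x + x \<in> S" using Suc.prems[of "Suc n"] by (simp add: algebra_simps)
  qed
  also have "g (real n * x) = real n * g x"
    using Suc by simp
  finally show ?case by (simp add: algebra_simps)
qed

text \<open>A Steinhaus-type argument: if \<open>E\<close> and its translate by \<open>y\<close>
  were disjoint, their union would have measure above \<open>3 * a / 2\<close>, yet it lies in
  \<open>{- a / 4..5 * a / 4}\<close>, whose length is exactly \<open>3 * a / 2\<close>.\<close>

lemma difference_of_large_set:
  fixes E :: "real set"
  assumes E: "E \<in> sets lebesgue" "E \<subseteq> {0..a}" and large: "measure lebesgue E > 3 * a / 4"
    and y: "\<bar>y\<bar> \<le> a / 4"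
  obtains u v where "u \<in> E" "v \<in> E" "y = u - v"
proof -
  have a: "0 \<le> a" using y by linarith
  let ?F = "(+) y ` E"
  have mE: "E \<in> lmeasurable"
    using E by (meson bounded_closed_interval bounded_set_imp_lmeasurable bounded_subset)
  then have mF: "?F \<in> lmeasurable" by (rule measurable_translation)
  have "E \<inter> ?F \<noteq> {}"
  proof
    assume "E \<inter> ?F = {}"
    then have "measure lebesgue (E \<union> ?F) = 2 * measure lebesgue E"
      using mE mF by (simp add: measure_Un3 measure_translation)
    moreover have "measure lebesgue (E \<union> ?F) \<le> measure lebesgue {- a / 4..5 * a / 4}"
    proof (rule measure_mono_fmeasurable)
      show "E \<union> ?F \<subseteq> {- a / 4..5 * a / 4}"
      proof -
        have "v \<in> {- a / 4..5 * a / 4} \<and> y + v \<in> {- a / 4..5 * a / 4}" if "v \<in> E" for v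
        proof -
          have "0 \<le> v" "v \<le> a" using subsetD[OF E(2) that] by simp_all
          then show ?thesis unfolding atLeastAtMost_iff using y by linarith
        qed
        then show ?thesis by blast
      qed
      show "E \<union> ?F \<in> sets lebesgue" using mE mF by auto
    qed auto
    ultimately show False using large a by simp
  qed
  then obtain u v where "u \<in> E" "v \<in> E" "u = y + v" by blast
  moreover from this have "y = u - v" by linarith
  ultimately show thesis by (intro that)
qed

lemma additive_on_measurable_imp_bounded:
  assumes meas: "g \<in> borel_measurable (lebesgue_on {0..a})" and add: "additive_on S g"
    and S: "{- a..a} \<subseteq> S" and a: "0 < a"
  shows "\<exists>B. \<forall>y. \<bar>y\<bar> \<le> a / 4 \<longrightarrow> \<bar>g y\<bar> \<le> B"
proof -
  let ?M = "lebesgue_on {0..a}"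
  interpret finite_measure ?M by (rule finite_measure_lebesgue_on) simp
  define E where "E n = {x \<in> space ?M. \<bar>g x\<bar> \<le> real n}" for n
  have sets_E: "E n \<in> sets ?M" for n
    unfolding E_def using meas by measurable
  \<comment> \<open>Continuity from below: the sets \<open>E n\<close> increase to
    \<open>{0..a}\<close>, since each \<open>\<bar>g x\<bar>\<close> is at most some natural
    number.\<close>
  have "(\<lambda>n. measure ?M (E n)) \<longlonglongrightarrow> measure ?M (\<Union>n. E n)"
    by (rule finite_Lim_measure_incseq) (use sets_E in \<open>auto simp: E_def incseq_def\<close>)
  moreover have "(\<Union>n. E n) = {0..a}"
    by (auto simp: E_def real_arch_simple)
  moreover have "measure ?M {0..a} = a"
    using a by (simp add: measure_restrict_space)
  ultimately have "(\<lambda>n. measure ?M (E n)) \<longlonglongrightarrow> a" by simp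
  then have "eventually (\<lambda>n. measure ?M (E n) > 3 * a / 4) sequentially"
    by (rule order_tendstoD) (use a in simp)
  then obtain n where n: "measure ?M (E n) > 3 * a / 4"
    by (auto simp: eventually_sequentially)
  have sub: "E n \<subseteq> {0..a}" by (auto simp: E_def)
  have leb: "E n \<in> sets lebesgue"
    using sets_E[of n] by (simp add: sets_restrict_space_iff)
  have "measure lebesgue (E n) > 3 * a / 4"
    using n sub by (simp add: measure_restrict_space)
  note diff = difference_of_large_set[OF leb sub this]
  have "\<bar>g y\<bar> \<le> 2 * real n" if y: "\<bar>y\<bar> \<le> a / 4" for y
  proof -
    obtain u v where uv: "u \<in> E n" "v \<in> E n" "y = u - v" using diff[OF y] .
    then have "u \<in> {0..a}" "v \<in> {0..a}" using sub by blast+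
    \<comment> \<open>The difference \<open>u - v\<close> may be negative, hence the symmetric
      interval in the hypothesis on \<open>S\<close>.\<close>
    then have "u \<in> {- a..a}" "v \<in> {- a..a}" "u - v \<in> {- a..a}" by auto
    then have "g (u - v) = g u - g v"
      using S by (intro additive_on_diff[OF add]) auto
    then show ?thesis using uv by (auto simp: E_def)
  qed
  then show ?thesis by blast
qed

lemma additive_on_bounded_imp_zero:
  assumes add: "additive_on {0..c} h" and hc: "h c = 0"
    and bound: "\<And>x. x \<in> {0..c} \<Longrightarrow> \<bar>h x\<bar> \<le> B" and x: "x \<in> {0..c}"
  shows "h x = 0"
proof -
  have halve: "\<bar>h x\<bar> \<le> B / 2 ^ n" if "x \<in> {0..c}" for x n
    using that
  proof (induction n arbitrary: x)
    case 0
    then show ?case using bound by simp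
  next
    case (Suc n)
    define y where "y = (if x \<le> c / 2 then x else c - x)"
    have y: "y \<in> {0..c}" "2 * y \<in> {0..c}"
      using Suc.prems by (auto simp: y_def)
    have "h (c - x) = h c - h x"
      by (rule additive_on_diff[OF add]) (use Suc.prems in auto)
    then have "\<bar>h x\<bar> = \<bar>h y\<bar>" using hc by (simp add: y_def)
    moreover have "h (2 * y) = 2 * h y"
      using additive_onD[OF add, of y y] y by simp
    \<comment> \<open>The induction hypothesis is applied at \<open>2 * y\<close>, where
      \<open>\<bar>h (2 * y)\<bar> = 2 * \<bar>h x\<bar>\<close>; this gains the factor 2.\<close>
    ultimately show ?case using Suc.IH[OF y(2)] by simp
  qed
  have "(\<lambda>n. B / 2 ^ n) \<longlonglongrightarrow> 0"
    using tendsto_mult_right_zero[OF LIMSEQ_power_zero[of "1 / 2 :: real"], of B]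
    by (simp add: power_one_over field_simps)
  then have "\<bar>h x\<bar> \<le> 0"
    by (rule LIMSEQ_le_const) (use halve[OF x] in blast)
  then show ?thesis by simp
qed

lemma additive_on_bounded_imp_linear:
  assumes S: "is_interval S" and add: "additive_on S g"
    and c: "0 < c" "{- c..c} \<subseteq> S" and bound: "\<And>x. x \<in> {0..c} \<Longrightarrow> \<bar>g x\<bar> \<le> B"
  shows "\<exists>\<beta>. \<forall>x\<in>S. g x = \<beta> * x"
proof -
  define \<beta> where "\<beta> = g c / c"
  define h where "h x = g x - \<beta> * x" for x
  have zero: "0 \<in> S" using c by auto
  have add_h: "additive_on S h"
    using add by (auto simp: additive_on_def h_def algebra_simps)
  have h0: "h x = 0" if x: "x \<in> {0..c}" for x
  proof (rule additive_on_bounded_imp_zero[OF _ _ _ x])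
    show "additive_on {0..c} h"
      using add_h by (rule additive_on_subset) (use c in auto)
    show "h c = 0" using c by (simp add: h_def \<beta>_def)
    show "\<bar>h t\<bar> \<le> B + \<bar>\<beta>\<bar> * c" if "t \<in> {0..c}" for t
    proof -
      have "\<bar>h t\<bar> \<le> \<bar>g t\<bar> + \<bar>\<beta> * t\<bar>" unfolding h_def by (rule abs_triangle_ineq4)
      also have "\<bar>\<beta> * t\<bar> \<le> \<bar>\<beta>\<bar> * c"
        using that by (auto simp: abs_mult intro: mult_left_mono)
      finally show ?thesis using bound[OF that] by linarith
    qed
  qed
  have h0': "h x = 0" if x: "x \<in> {- c..c}" for x
  proof (cases "0 \<le> x")
    case True
    then show ?thesis using h0 x by simp
  next
    case False
    have "- x \<in> S" "x \<in> S" using c(2) x by auto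
    then have "h (- x) = - h x" by (intro additive_on_uminus[OF add_h zero]) auto
    then show ?thesis using h0[of "- x"] x False by simp
  qed
  have "h x = 0" if x: "x \<in> S" for x
  proof -
    \<comment> \<open>With this \<open>n\<close> the point \<open>x / real n\<close> falls into
      \<open>{- c..c}\<close>, where \<open>h\<close> is already known to vanish.\<close>
    obtain n where n: "\<bar>x\<bar> / c < real n" using reals_Archimedean2 by blast
    moreover have "0 \<le> \<bar>x\<bar> / c" using c by simp
    ultimately have n0: "0 < real n" by linarith
    have "\<bar>x\<bar> \<le> c * real n" using n c by (simp add: field_simps)
    then have "\<bar>x / real n\<bar> \<le> c" using n0 by (simp add: field_simps)
    then have small: "h (x / real n) = 0" by (intro h0') (simp add: abs_le_iff minus_le_iff del: abs_divide)
    have "h (real n * (x / real n)) = real n * h (x / real n)"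
    proof (rule additive_on_multiple[OF add_h zero])
      fix k assume "k \<le> n"
      then have "0 \<le> real k / real n" "real k / real n \<le> 1" using n0 by auto
      \<comment> \<open>Each intermediate multiple is a convex combination of \<open>0\<close> and
        \<open>x\<close>, so it stays in the interval \<open>S\<close>.\<close>
      then have "(real k / real n) *\<^sub>R x \<in> S"
        using is_interval_convex[OF S] zero x convexD_alt[of S 0 x "real k / real n"] by simp
      then show "real k * (x / real n) \<in> S" by simp
    qed
    then show ?thesis using small n0 by simp
  qed
  then show ?thesis by (auto simp: h_def intro!: exI[of _ \<beta>])
qed

lemma additive_on_measurable_imp_linear:
  assumes "is_interval S" "I \<subseteq> S" "0 \<in> interior I"
    and meas: "g \<in> borel_measurable (lebesgue_on I)" and add: "additive_on S g"
  shows "\<exists>\<beta>. \<forall>x\<in>S. g x = \<beta> * x"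
proof -
  obtain a where a: "0 < a" "cball 0 a \<subseteq> I"
    using assms(3) by (auto simp: mem_interior_cball)
  then have I: "{- a..a} \<subseteq> I" by (simp add: cball_eq_atLeastAtMost)
  have "g \<in> borel_measurable (lebesgue_on {0..a})"
    using meas by (rule measurable_restrict_mono) (use I a in auto)
  then obtain B where B: "\<And>y. \<bar>y\<bar> \<le> a / 4 \<Longrightarrow> \<bar>g y\<bar> \<le> B"
    using additive_on_measurable_imp_bounded[OF _ add] I assms(2) a(1) by (meson subset_trans)
  show ?thesis
  proof (rule additive_on_bounded_imp_linear[OF assms(1) add])
    show "0 < a / 4" using a by simp
    \<comment> \<open>The quarter is the range of translations on which the measure argument bounds
      \<open>g\<close>.\<close>
    have "{- (a / 4)..a / 4} \<subseteq> {- a..a}" using a by auto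
    then show "{- (a / 4)..a / 4} \<subseteq> S" using I assms(2) by blast
    show "\<bar>g x\<bar> \<le> B" if "x \<in> {0..a / 4}" for x using that by (intro B) auto
  qed
qed

theorem theorem1:
  fixes I J :: "real set" and g :: "real \<Rightarrow> real"
  assumes "is_interval I" and "is_interval J"
    and "I \<subseteq> J"
    and "0 \<in> interior I" and "0 \<in> interior J"
  shows "(g \<in> borel_measurable (lebesgue_on I) \<and> additive_on J g
            \<longleftrightarrow> continuous_on I g \<and> additive_on J g)
       \<and> (continuous_on I g \<and> additive_on J g
            \<longleftrightarrow> (\<exists>\<beta>. \<forall>x\<in>J. g x = \<beta> * x))"
proof -
  have "I \<in> sets lebesgue"
    using assms(1) by (simp add: real_interval_borel_measurable)
  then have "g \<in> borel_measurable (lebesgue_on I)" if "continuous_on I g"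
    using that by (rule continuous_imp_measurable_on_sets_lebesgue[rotated])
  moreover have "continuous_on I g \<and> additive_on J g" if linear: "\<exists>\<beta>. \<forall>x\<in>J. g x = \<beta> * x"
  proof -
    obtain \<beta> where \<beta>: "\<And>x. x \<in> J \<Longrightarrow> g x = \<beta> * x" using linear by blast
    have "continuous_on I (\<lambda>x. \<beta> * x)" by (intro continuous_intros)
    then have "continuous_on I g"
      by (rule continuous_on_eq) (use \<beta> assms(3) in auto)
    then show ?thesis using \<beta> by (simp add: additive_on_def algebra_simps)
  qed
  \<comment> \<open>The cycle closes: linear implies continuous, continuous implies measurable, and
    measurable with additive implies linear.\<close>
  ultimately show ?thesis
    using additive_on_measurable_imp_linear[OF assms(2-4)] by blast
qed

end
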